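(* For all $n \geq 2$, $$A_n(q,u)=A_{n-1}(q,u)+u\sum_{k=1}^{n-2}q^k\binom{n-2}{k}_qA_{n-k-1}(q,u),$$ with $A_1(q,u)=u$.
   Context: Permutations $\pi=\pi_1\cdots\pi_n$ of $[n]=\{1,\ldots,n\}$ are written in one-line notation. An inversion of $\pi$ is a pair $(i,j)$ with $1\le i<j\le n$ and $\pi_i>\pi_j$; $\mathrm{inv}(\pi)$ is the number of inversions. A run of $\pi$ is a maximal increasing sequence of consecutive entries; $\mathrm{run}(\pi)$ is the number of runs. A permutation is run-sorted if $\pi_1=1$ and the first entries of its runs, read from left to right, form an increasing sequence. $\mathcal{R}_n$ denotes the set of run-sorted permutations of $[n]$. For $n\geq 1$ and indeterminates $q,u$, let $$A_n(q,u)=\sum_{\pi\in\mathcal{R}_n}q^{\mathrm{inv}(\pi)}u^{\mathrm{run}(\pi)}.$$ For $n\ge 1$, $n_q=1+q+\cdots+q^{n-1}$ (with $0_q=0$), $n_q^!=\prod_{i=1}^n i_q$ (with $0_q^!=1$), and $\binom{n}{k}_q=\frac{n_q^!}{k_q^!(n-k)_q^!}$ if $0\le k\le n$ and $0$ otherwise. *)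

theory Defs
  imports "HOL-Combinatorics.Multiset_Permutations" "HOL-Computational_Algebra.Polynomial"
begin

text \<open>
  A permutation of $[n]$ in one-line notation is an element of
  \<^term>\<open>permutations_of_set {1..n}\<close>, i.e. a distinct list whose set of entries is
  $\{1,\ldots,n\}$. List positions are counted from 0.
\<close>

definition inv_count :: "nat list \<Rightarrow> nat" where
  "inv_count xs = card {(i, j). i < j \<and> j < length xs \<and> xs ! i > xs ! j}"

definition increasing_between :: "nat list \<Rightarrow> nat \<Rightarrow> nat \<Rightarrow> bool" where
  "increasing_between xs i j \<longleftrightarrow>
     i \<le> j \<and> j < length xs \<and> strict_mono_on {i..j} (\<lambda>k. xs ! k)"

text \<open>A run is identified with the pair of its first and last position.\<close>

definition is_run :: "nat list \<Rightarrow> nat \<Rightarrow> nat \<Rightarrow> bool" where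
  "is_run xs i j \<longleftrightarrow>
     increasing_between xs i j \<and>
     (\<forall>i' j'. increasing_between xs i' j' \<and> i' \<le> i \<and> j \<le> j' \<longrightarrow> i' = i \<and> j' = j)"

definition run_count :: "nat list \<Rightarrow> nat" where
  "run_count xs = card {(i, j). is_run xs i j}"

definition run_sorted :: "nat list \<Rightarrow> bool" where
  "run_sorted xs \<longleftrightarrow>
     xs \<noteq> [] \<and> hd xs = 1 \<and>
     (\<forall>i j i' j'. is_run xs i j \<and> is_run xs i' j' \<and> i < i' \<longrightarrow> xs ! i < xs ! i')"

definition run_sorted_perms :: "nat \<Rightarrow> nat list set" where
  "run_sorted_perms n = {xs \<in> permutations_of_set {1..n}. run_sorted xs}"

text \<open>
  The ring $\mathbb{Z}[q,u]$ is represented as $\mathbb{Z}[q][u]$: \<open>u\<close> is the outer and \<open>q\<close>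
  the inner indeterminate.
\<close>

definition q_indet :: "int poly poly" where
  "q_indet = [:[:0, 1:]:]"

definition u_indet :: "int poly poly" where
  "u_indet = [:0, 1:]"

definition run_sorted_poly :: "nat \<Rightarrow> int poly poly" where
  "run_sorted_poly n =
     (\<Sum>xs\<in>run_sorted_perms n. q_indet ^ inv_count xs * u_indet ^ run_count xs)"

definition q_number :: "nat \<Rightarrow> int poly poly" where
  "q_number n = (\<Sum>i<n. q_indet ^ i)"

definition q_factorial :: "nat \<Rightarrow> int poly poly" where
  "q_factorial n = (\<Prod>i=1..n. q_number i)"

text \<open>
  The denominator divides the numerator in $\mathbb{Z}[q]$, so \<open>div\<close> is exact here and yields
  the same element as division in the field of fractions.
\<close>

definition q_binomial :: "nat \<Rightarrow> nat \<Rightarrow> int poly poly" where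
  "q_binomial n k =
     (if k \<le> n then q_factorial n div (q_factorial k * q_factorial (n - k)) else 0)"

end

theory Submission imports Defs "HOL-Library.Infinite_Set" begin

text \<open>
  Why the recurrence holds. In a run-sorted permutation $\pi$ of $[n]$ with $n \ge 2$, every
  entry between 1 and 2 exceeds 2. If two adjacent ones formed a descent, its bottom would
  start a run before 2 with a first entry larger than 2, and as 2 starts a later run this would
  violate run-sortedness. Hence $\pi = 1\,S\,\rho$, where $S$ is a subset of $\{3,\ldots,n\}$
  written increasingly and $\rho$, which begins with 2, is a run-sorted arrangement of
  $\{2,\ldots,n\} \setminus S$. Conversely every such pair $(S, \rho)$ gives a run-sorted
  permutation; this is the bijection \<open>bij_betw_splice_min\<close>.

  Statistics are additive (\<open>splice_min_statistics\<close>). If $S$ is empty, then 1 merely prolongs the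
  first run of $\rho$; otherwise $1\,S$ is one additional run. Each element of $S$ forms an
  inversion with 2, and the remaining new inversions are those between $S$ and its complement in
  $\{3,\ldots,n\}$. Since inversions and runs see only the relative order of the entries,
  the arrangements $\rho$ contribute $A_{n-1-k}(q,u)$ with $k = |S|$. Summing
  $q$ to the number of cross inversions over all $k$-subsets of an $m$-element set gives the
  Gaussian binomial coefficient (\<open>subset_inv_poly_eq_q_binomial\<close>), so $k = 0$ yields the summand
  $A_{n-1}(q,u)$ and $k \ge 1$ the remaining terms.

  Runs are handled through the list of their first entries, \<open>run_heads\<close>, which is computed
  by recursion and behaves well under concatenation.
\<close>

section \<open>First entries of runs\<close>

text \<open>
  The entry \<open>p\<close> stands immediately before the list, so that the recursion and the
  concatenation law need no special treatment of the first entry.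
\<close>
fun descent_bottoms :: "nat \<Rightarrow> nat list \<Rightarrow> nat list" where
  "descent_bottoms p [] = []"
| "descent_bottoms p (x # xs) = (if p < x then [] else [x]) @ descent_bottoms x xs"

fun run_heads :: "nat list \<Rightarrow> nat list" where
  "run_heads [] = []"
| "run_heads (x # xs) = x # descent_bottoms x xs"

definition run_start :: "nat list \<Rightarrow> nat \<Rightarrow> bool" where
  "run_start xs i \<longleftrightarrow> i = 0 \<or> \<not> xs ! (i - 1) < xs ! i"

section \<open>Runs as position intervals and their first entries\<close>
lemma increasing_between_iff:
  "increasing_between xs i j \<longleftrightarrow>
     i \<le> j \<and> j < length xs \<and> (\<forall>k. i \<le> k \<and> k < j \<longrightarrow> xs ! k < xs ! Suc k)"
proof -
  have "xs ! k < xs ! l" if "\<forall>k. i \<le> k \<and> k < j \<longrightarrow> xs ! k < xs ! Suc k" "i \<le> k" "k < l" "l \<le> j" for k l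
    using that(3,4)
  proof (induction l)
    case (Suc l)
    have "xs ! l < xs ! Suc l" using that Suc.prems by simp
    with Suc show ?case by (cases "k = l") auto
  qed simp
  then show ?thesis
    by (auto simp: increasing_between_def strict_mono_on_def)
qed

lemma is_run_unique_end:
  assumes "is_run xs i j" "is_run xs i j'"
  shows "j = j'"
  using assms unfolding is_run_def by (metis nat_le_linear order_refl)

text \<open>
  From a position that is not an ascent top, the longest increasing stretch to the right is also
  maximal to the left; conversely a run whose first position is an ascent top could be prolonged.
\<close>
lemma ex_is_run_iff:
  "(\<exists>j. is_run xs i j) \<longleftrightarrow> i < length xs \<and> run_start xs i"
proof
  assume "\<exists>j. is_run xs i j"
  then obtain j where j: "is_run xs i j" by blast
  then have inc: "increasing_between xs i j" by (simp add: is_run_def)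
  have "run_start xs i"
  proof (rule ccontr)
    assume "\<not> run_start xs i"
    then have i: "i > 0" "xs ! (i - 1) < xs ! i" by (auto simp: run_start_def)
    have "xs ! k < xs ! Suc k" if "i - 1 \<le> k" "k < j" for k
      using that inc i by (cases "k = i - 1") (auto simp: increasing_between_iff)
    then have "increasing_between xs (i - 1) j"
      using inc by (auto simp: increasing_between_iff)
    with j i show False unfolding is_run_def by (metis diff_le_self diff_less less_irrefl order_refl zero_less_one)
  qed
  with inc show "i < length xs \<and> run_start xs i" by (auto simp: increasing_between_iff)
next
  assume i: "i < length xs \<and> run_start xs i"
  define j where "j = (GREATEST j. increasing_between xs i j)"
  have base: "increasing_between xs i i" using i by (simp add: increasing_between_iff)
  have bound: "increasing_between xs i j \<Longrightarrow> j \<le> length xs" for j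
    by (simp add: increasing_between_iff)
  have j: "increasing_between xs i j" unfolding j_def
    by (rule GreatestI_nat[of _ i "length xs"]) (use base bound in auto)
  have max: "j' \<le> j" if "increasing_between xs i j'" for j' unfolding j_def
    by (rule Greatest_le_nat[of _ _ "length xs"]) (use that bound in auto)
  have "i' = i \<and> j' = j" if h: "increasing_between xs i' j'" "i' \<le> i" "j \<le> j'" for i' j'
  proof -
    have "i' = i"
    proof (rule ccontr)
      assume "i' \<noteq> i"
      then have "i' \<le> i - 1" "i - 1 < j'" "i > 0"
        using h j by (auto simp: increasing_between_iff)
      then have "xs ! (i - 1) < xs ! Suc (i - 1)"
        using h by (auto simp: increasing_between_iff)
      with i \<open>i > 0\<close> show False by (auto simp: run_start_def)
    qed
    with h max show ?thesis by (auto intro: le_antisym)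
  qed
  with j show "\<exists>j. is_run xs i j" unfolding is_run_def by blast
qed

lemma descent_bottoms_conv_filter:
  "descent_bottoms p xs = map ((!) xs) (filter (\<lambda>i. \<not> (p # xs) ! i < xs ! i) [0..<length xs])"
proof (induction xs arbitrary: p)
  case (Cons x xs)
  have "[0..<length (x # xs)] = 0 # map Suc [0..<length xs]"
    by (simp add: upt_conv_Cons map_Suc_upt del: upt_Suc)
  then show ?case using Cons[of x] by (simp add: filter_map o_def del: upt_Suc)
qed simp

lemma run_heads_conv_filter:
  "run_heads xs = map ((!) xs) (filter (run_start xs) [0..<length xs])"
proof (cases xs)
  case (Cons x ys)
  have "[0..<length (x # ys)] = 0 # map Suc [0..<length ys]"
    by (simp add: upt_conv_Cons map_Suc_upt del: upt_Suc)
  then show ?thesis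
    by (simp add: Cons filter_map o_def run_start_def descent_bottoms_conv_filter del: upt_Suc)
qed simp

text \<open>
  A run is determined by where it begins, so counting runs amounts to counting first positions.
\<close>
lemma run_count_conv_run_heads: "run_count xs = length (run_heads xs)"
proof -
  have "bij_betw fst {(i, j). is_run xs i j} {i. i < length xs \<and> run_start xs i}"
    unfolding bij_betw_def inj_on_def
    using ex_is_run_iff[of xs] is_run_unique_end[of xs] by (fastforce simp: image_iff)
  then have "run_count xs = card {i. i < length xs \<and> run_start xs i}"
    unfolding run_count_def by (rule bij_betw_same_card)
  also have "\<dots> = card (set (filter (run_start xs) [0..<length xs]))"
    by (rule arg_cong[of _ _ card]) auto
  also have "\<dots> = length (run_heads xs)"
    by (simp add: run_heads_conv_filter distinct_card del: set_filter)
  finally show ?thesis .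
qed

lemma sorted_wrt_filter_upt_iff:
  "sorted_wrt P (filter Q [0..<n]) \<longleftrightarrow> (\<forall>i j. i < j \<and> j < n \<and> Q i \<and> Q j \<longrightarrow> P i j)"
  by (induction n) (auto simp: sorted_wrt_append less_Suc_eq)

lemma run_sorted_iff:
  "run_sorted xs \<longleftrightarrow> xs \<noteq> [] \<and> hd xs = 1 \<and> sorted_wrt (<) (run_heads xs)"
proof -
  have "(\<forall>i j i' j'. is_run xs i j \<and> is_run xs i' j' \<and> i < i' \<longrightarrow> xs ! i < xs ! i') \<longleftrightarrow>
        (\<forall>i i'. (\<exists>j. is_run xs i j) \<and> (\<exists>j. is_run xs i' j) \<and> i < i' \<longrightarrow> xs ! i < xs ! i')"
    by blast
  also have "\<dots> \<longleftrightarrow> sorted_wrt (<) (run_heads xs)"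
    unfolding ex_is_run_iff run_heads_conv_filter sorted_wrt_map sorted_wrt_filter_upt_iff
    by (meson order.strict_trans)
  finally show ?thesis by (simp add: run_sorted_def)
qed

section \<open>Concatenation and relabelling\<close>
lemma descent_bottoms_append:
  "descent_bottoms p (xs @ ys) = descent_bottoms p xs @ descent_bottoms (last (p # xs)) ys"
  by (induction xs arbitrary: p) auto

lemma set_descent_bottoms_subset: "set (descent_bottoms p xs) \<subseteq> set xs"
  by (induction xs arbitrary: p) auto

lemma descent_bottoms_eq_Nil_iff: "descent_bottoms p xs = [] \<longleftrightarrow> sorted_wrt (<) (p # xs)"
  by (induction xs arbitrary: p) (simp_all add: sorted_wrt1 sorted_wrt2 del: sorted_wrt.simps(2))

text \<open>Going left from an entry within its run, the values decrease down to the first entry.\<close>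
lemma ex_run_head_le: "y \<in> set xs \<Longrightarrow> \<exists>h\<in>set (p # descent_bottoms p xs). h \<le> y"
proof (induction xs arbitrary: p)
  case (Cons x xs)
  obtain h where "h \<in> set (x # descent_bottoms x xs)" "h \<le> y"
    using Cons.IH[of x] Cons.prems by auto
  then show ?case by (cases "p < x") auto
qed simp

text \<open>
  Consequently the condition that a run-sorted permutation begins with 1 can be replaced by
  non-emptiness, which makes sense over every alphabet.
\<close>
lemma hd_le_if_run_heads_sorted:
  assumes "sorted_wrt (<) (run_heads xs)" "y \<in> set xs"
  shows "hd xs \<le> y"
proof (cases xs)
  case (Cons x ys)
  then show ?thesis using assms ex_run_head_le[of y ys x] by fastforce
qed (use assms in simp)

lemma descent_bottoms_map:
  assumes "strict_mono_on (insert p (set xs)) f"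
  shows "descent_bottoms (f p) (map f xs) = map f (descent_bottoms p xs)"
  using assms
proof (induction xs arbitrary: p)
  case (Cons x xs)
  have "strict_mono_on (insert x (set xs)) f"
    by (rule monotone_on_subset[OF Cons.prems]) auto
  moreover have "f p < f x \<longleftrightarrow> p < x"
    using Cons.prems by (simp add: strict_mono_on_less)
  ultimately show ?case using Cons.IH by simp
qed simp

lemma run_heads_map:
  assumes "strict_mono_on (set xs) f"
  shows "run_heads (map f xs) = map f (run_heads xs)"
  using assms by (cases xs) (simp_all add: descent_bottoms_map)

lemma set_run_heads_subset: "set (run_heads xs) \<subseteq> set xs"
  using set_descent_bottoms_subset by (cases xs) auto

lemma sorted_run_heads_map_iff:
  assumes "strict_mono_on (set xs) f"
  shows "sorted_wrt (<) (run_heads (map f xs)) \<longleftrightarrow> sorted_wrt (<) (run_heads xs)"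
proof -
  have "sorted_wrt (\<lambda>x y. f x < f y) (run_heads xs) \<longleftrightarrow> sorted_wrt (<) (run_heads xs)"
    by (intro iffI; erule sorted_wrt_mono_rel[rotated])
      (use set_run_heads_subset[of xs] in \<open>auto simp: strict_mono_on_less[OF assms] subset_iff\<close>)
  then show ?thesis by (simp add: run_heads_map[OF assms] sorted_wrt_map)
qed

section \<open>Inversions\<close>
lemma inv_count_map:
  assumes "strict_mono_on (set xs) f"
  shows "inv_count (map f xs) = inv_count xs"
proof -
  have "f (xs ! j) < f (xs ! i) \<longleftrightarrow> xs ! j < xs ! i" if "i < j" "j < length xs" for i j
    using assms that by (simp add: strict_mono_on_less)
  then show ?thesis unfolding inv_count_def by (intro arg_cong[of _ _ card]) auto
qed

lemma inv_count_Nil: "inv_count [] = 0"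
  by (simp add: inv_count_def)

lemma inv_count_Cons:
  "inv_count (x # xs) = length (filter (\<lambda>y. y < x) xs) + inv_count xs"
proof -
  let ?I = "{(i, j). i < j \<and> j < length xs \<and> xs ! i > xs ! j}"
  let ?J = "{j. j < length xs \<and> xs ! j < x}"
  have "{(i, j). i < j \<and> j < length (x # xs) \<and> (x # xs) ! i > (x # xs) ! j} =
        (\<lambda>j. (0, Suc j)) ` ?J \<union> map_prod Suc Suc ` ?I" (is "?L = ?R")
  proof (rule set_eqI)
    fix p :: "nat \<times> nat"
    obtain i j where p: "p = (i, j)" by fastforce
    show "p \<in> ?L \<longleftrightarrow> p \<in> ?R"
      unfolding p by (cases i; cases j) (auto simp: image_iff)
  qed
  moreover have "finite ?I"
    by (rule finite_subset[of _ "{..<length xs} \<times> {..<length xs}"]) auto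
  moreover have "(\<lambda>j. (0, Suc j)) ` ?J \<inter> map_prod Suc Suc ` ?I = {}" by auto
  moreover have "finite ?J" by simp
  ultimately have "inv_count (x # xs) = card ((\<lambda>j. (0::nat, Suc j)) ` ?J) + card (map_prod Suc Suc ` ?I)"
    unfolding inv_count_def by (simp only: card_Un_disjoint finite_imageI)
  also have "card ((\<lambda>j. (0::nat, Suc j)) ` ?J) = length (filter (\<lambda>y. y < x) xs)"
    by (subst card_image) (auto simp: inj_on_def length_filter_conv_card)
  also have "card (map_prod Suc Suc ` ?I) = inv_count xs"
    unfolding inv_count_def by (rule card_image) (auto simp: inj_on_def)
  finally show ?thesis .
qed

text \<open>The number of inversions between two blocks when \<open>S\<close> stands to the left of \<open>T\<close>.\<close>
definition cross_inv :: "nat set \<Rightarrow> nat set \<Rightarrow> nat" where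
  "cross_inv S T = (\<Sum>s\<in>S. card {t \<in> T. t < s})"

lemma inv_count_append:
  assumes "distinct (xs @ ys)"
  shows "inv_count (xs @ ys) = inv_count xs + cross_inv (set xs) (set ys) + inv_count ys"
  using assms
proof (induction xs)
  case (Cons x xs)
  then have "card {t \<in> set ys. t < x} = length (filter (\<lambda>y. y < x) ys)"
    by (metis distinct_append distinct_card distinct_filter set_filter)
  with Cons show ?case by (simp add: inv_count_Cons cross_inv_def)
qed (simp add: inv_count_Nil cross_inv_def)

lemma inv_count_sorted: "sorted xs \<Longrightarrow> inv_count xs = 0"
  by (induction xs) (auto simp: inv_count_Nil inv_count_Cons filter_empty_conv)

section \<open>Gaussian binomial coefficients count subsets by inversions\<close>
definition subset_inv_poly :: "nat set \<Rightarrow> nat \<Rightarrow> int poly poly" where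
  "subset_inv_poly T k = (\<Sum>S | S \<subseteq> T \<and> card S = k. q_indet ^ cross_inv S (T - S))"

lemma subset_inv_poly_0: "finite T \<Longrightarrow> subset_inv_poly T 0 = 1"
proof -
  assume "finite T"
  then have "{S. S \<subseteq> T \<and> card S = 0} = {{}}" by (auto dest: finite_subset)
  then show ?thesis by (simp add: subset_inv_poly_def cross_inv_def)
qed

text \<open>
  The Pascal rule, by deciding whether the maximum \<open>b\<close> belongs to the subset. If it does not,
  it lies in the right block and causes no inversion; if it does, it forms an inversion with
  each of the \<open>card T - k\<close> elements left out.
\<close>
lemma subset_inv_poly_insert_max:
  assumes fin: "finite T" and max: "\<forall>t\<in>T. t < b"
  shows "subset_inv_poly (insert b T) (Suc k) =
    subset_inv_poly T (Suc k) + q_indet ^ (card T - k) * subset_inv_poly T k"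
proof -
  let ?P = "\<lambda>T k. {S. S \<subseteq> T \<and> card S = k}"
  let ?w = "\<lambda>S. q_indet ^ cross_inv S (insert b T - S)"
  have b: "b \<notin> T" using max by blast
  have eq: "?P (insert b T) (Suc k) = ?P T (Suc k) \<union> insert b ` ?P T k" (is "?L = ?R")
  proof (rule set_eqI)
    fix S
    show "S \<in> ?L \<longleftrightarrow> S \<in> ?R"
    proof (cases "b \<in> S")
      case True
      have "S \<in> insert b ` ?P T k" if "S \<in> ?L"
      proof
        show "S = insert b (S - {b})" using True by auto
        have "finite S" using that fin by (auto dest: finite_subset)
        then show "S - {b} \<in> ?P T k" using that True by auto
      qed
      moreover have "S \<in> ?L" if ins: "S \<in> insert b ` ?P T k"
      proof -
        obtain S' where S': "S = insert b S'" "S' \<subseteq> T" "card S' = k" using ins by auto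
        then have "finite S'" "b \<notin> S'" using fin b by (auto dest: finite_subset)
        with S' show ?thesis by auto
      qed
      ultimately show ?thesis using True b by blast
    qed auto
  qed
  have fins: "finite (?P T j)" for j
    by (rule finite_subset[of _ "Pow T"]) (use fin in auto)
  have "subset_inv_poly (insert b T) (Suc k) = sum ?w (?P T (Suc k)) + sum ?w (insert b ` ?P T k)"
    unfolding subset_inv_poly_def eq
    by (rule sum.union_disjoint) (use fins b in auto)
  also have "sum ?w (?P T (Suc k)) = subset_inv_poly T (Suc k)"
    unfolding subset_inv_poly_def
  proof (rule sum.cong[OF refl])
    fix S assume S: "S \<in> ?P T (Suc k)"
    have "{t \<in> insert b T - S. t < s} = {t \<in> T - S. t < s}" if "s \<in> S" for s
      using that S max by force
    then show "?w S = q_indet ^ cross_inv S (T - S)" by (simp add: cross_inv_def)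
  qed
  also have "sum ?w (insert b ` ?P T k) = (\<Sum>S\<in>?P T k. ?w (insert b S))"
    by (rule sum.reindex_cong[of "insert b"]) (use b in \<open>auto simp: inj_on_def\<close>)
  also have "\<dots> = (\<Sum>S\<in>?P T k. q_indet ^ (card T - k) * q_indet ^ cross_inv S (T - S))"
  proof (rule sum.cong[OF refl])
    fix S assume S: "S \<in> ?P T k"
    then have S': "finite S" "b \<notin> S" using fin b by (auto dest: finite_subset)
    have "{t \<in> T - S. t < b} = T - S" using max by auto
    moreover have "card (T - S) = card T - k" using S S' by (simp add: card_Diff_subset)
    moreover have "insert b T - insert b S = T - S" using b by auto
    ultimately have "cross_inv (insert b S) (insert b T - insert b S) = card T - k + cross_inv S (T - S)"
      using S' by (simp add: cross_inv_def)
    then show "?w (insert b S) = q_indet ^ (card T - k) * q_indet ^ cross_inv S (T - S)"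
      by (simp add: power_add)
  qed
  also have "\<dots> = q_indet ^ (card T - k) * subset_inv_poly T k"
    by (simp add: subset_inv_poly_def sum_distrib_left)
  finally show ?thesis .
qed

lemma q_number_add: "q_number (m + n) = q_number m + q_indet ^ m * q_number n"
  by (induction n) (simp_all add: q_number_def power_add algebra_simps)

lemma q_factorial_0: "q_factorial 0 = 1"
  by (simp add: q_factorial_def)

lemma q_factorial_Suc: "q_factorial (Suc n) = q_number (Suc n) * q_factorial n"
  by (simp add: q_factorial_def)

text \<open>At $q = 1$ the $q$-number takes the value \<open>Suc n\<close>.\<close>
lemma q_number_nonzero: "q_number (Suc n) \<noteq> 0"
proof
  assume "q_number (Suc n) = 0"
  then have "poly (poly (q_number (Suc n)) 0) 1 = 0" by simp
  then show False by (simp add: q_number_def q_indet_def poly_sum)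
qed

lemma q_factorial_nonzero: "q_factorial n \<noteq> 0"
  by (induction n) (simp_all add: q_factorial_0 q_factorial_Suc q_number_nonzero)

text \<open>
  The Pascal rule turns this division-free form for $m$ into that for $m + 1$ by means of
  $(m+1)_q = (m-j)_q + q^{m-j} (j+1)_q$. As the ring is an integral domain and $q$-factorials
  do not vanish, it shows that the division in the definition of the Gaussian
  binomial is exact.
\<close>
lemma subset_inv_poly_mult_factorials:
  assumes "finite T" "k \<le> card T"
  shows "subset_inv_poly T k * (q_factorial k * q_factorial (card T - k)) = q_factorial (card T)"
  using assms
proof (induction T arbitrary: k rule: finite_linorder_max_induct)
  case empty
  then show ?case by (simp add: subset_inv_poly_0 q_factorial_0)
next
  case (insert b T)
  let ?m = "card T"
  have card: "card (insert b T) = Suc ?m" using insert.hyps by auto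
  show ?case
  proof (cases k)
    case 0
    then show ?thesis using insert.hyps by (simp add: subset_inv_poly_0 q_factorial_0)
  next
    case (Suc j)
    then have j: "j \<le> ?m" using insert.prems card by simp
    have IH2: "subset_inv_poly T j * (q_factorial j * q_factorial (?m - j)) = q_factorial ?m"
      by (rule insert.IH[OF j])
    have first: "subset_inv_poly T (Suc j) * (q_factorial (Suc j) * q_factorial (?m - j)) =
          q_number (?m - j) * q_factorial ?m"
    proof (cases "j = ?m")
      \<comment> \<open>There is no subset of size \<open>Suc ?m\<close>, and the right-hand side contains $0_q = 0$.\<close>
      case True
      have "card S \<noteq> Suc ?m" if "S \<subseteq> T" for S
        using card_mono[OF insert.hyps(1) that] by simp
      then have "{S. S \<subseteq> T \<and> card S = Suc ?m} = {}" by blast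
      then have "subset_inv_poly T (Suc ?m) = 0"
        unfolding subset_inv_poly_def by (simp only: sum.empty)
      with True show ?thesis by (simp add: q_number_def)
    next
      case False
      then obtain d where d: "?m - j = Suc d" "?m - Suc j = d" using j by (cases "?m - j") auto
      have "subset_inv_poly T (Suc j) * (q_factorial (Suc j) * q_factorial d) = q_factorial ?m"
        using insert.IH[of "Suc j"] False j d(2) by simp
      moreover have "a * (b * (c * e)) = c * (a * (b * e))" for a b c e :: "int poly poly"
        by (simp only: mult_ac)
      ultimately show ?thesis unfolding d(1) q_factorial_Suc[of d] by metis
    qed
    have "?m - j + Suc j = Suc ?m" using j by simp
    then have "q_number (Suc ?m) = q_number (?m - j) + q_indet ^ (?m - j) * q_number (Suc j)"
      by (metis q_number_add)
    then have "q_factorial (Suc ?m) = q_number (?m - j) * q_factorial ?m +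
        q_indet ^ (?m - j) * (q_number (Suc j) * q_factorial ?m)"
      unfolding q_factorial_Suc[of ?m] by (simp only: distrib_right mult.assoc)
    also have "\<dots> = subset_inv_poly T (Suc j) * (q_factorial (Suc j) * q_factorial (?m - j)) +
        q_indet ^ (?m - j) * (q_number (Suc j) *
          (subset_inv_poly T j * (q_factorial j * q_factorial (?m - j))))"
      by (simp only: first IH2)
    also have "\<dots> = (subset_inv_poly T (Suc j) + q_indet ^ (?m - j) * subset_inv_poly T j) *
        (q_factorial (Suc j) * q_factorial (?m - j))"
      unfolding q_factorial_Suc[of j] by (simp only: distrib_right distrib_left mult_ac)
    also have "\<dots> = subset_inv_poly (insert b T) k * (q_factorial k * q_factorial (Suc ?m - k))"
      using Suc j insert.hyps by (simp add: subset_inv_poly_insert_max)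
    finally show ?thesis by (simp only: card)
  qed
qed

lemma subset_inv_poly_eq_q_binomial:
  assumes "finite T" "k \<le> card T"
  shows "subset_inv_poly T k = q_binomial (card T) k"
proof -
  have "q_factorial k * q_factorial (card T - k) \<noteq> 0" by (simp add: q_factorial_nonzero)
  then show ?thesis
    unfolding q_binomial_def subset_inv_poly_mult_factorials[OF assms, symmetric]
    using assms(2) by (metis nonzero_mult_div_cancel_right)
qed

section \<open>Run-sorted arrangements of a finite set\<close>

text \<open>
  Run-sorted permutations over an arbitrary alphabet. The empty list counts as run-sorted here,
  which matters only for the empty alphabet.
\<close>
definition run_sorted_arrangements :: "nat set \<Rightarrow> nat list set" where
  "run_sorted_arrangements A = {xs \<in> permutations_of_set A. sorted_wrt (<) (run_heads xs)}"

definition arrangement_poly :: "nat set \<Rightarrow> int poly poly" where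
  "arrangement_poly A =
     (\<Sum>xs\<in>run_sorted_arrangements A. q_indet ^ inv_count xs * u_indet ^ run_count xs)"

lemma run_sorted_arrangements_hd:
  assumes "xs \<in> run_sorted_arrangements A" "a \<in> A" "\<And>b. b \<in> A \<Longrightarrow> a \<le> b"
  obtains ys where "xs = a # ys"
proof -
  have xs: "set xs = A" "sorted_wrt (<) (run_heads xs)"
    using assms(1) by (auto simp: run_sorted_arrangements_def permutations_of_set_def)
  have "xs \<noteq> []" using xs assms(2) by auto
  moreover have "hd xs \<le> a" by (rule hd_le_if_run_heads_sorted) (use xs assms in auto)
  moreover have "a \<le> hd xs" using \<open>xs \<noteq> []\<close> xs by (intro assms(3)) auto
  ultimately show ?thesis using that by (cases xs) auto
qed

lemma run_sorted_poly_conv_arrangement_poly: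
  assumes "n \<ge> 1"
  shows "run_sorted_poly n = arrangement_poly {1..n}"
proof -
  have "run_sorted_perms n = run_sorted_arrangements {1..n}" (is "?L = ?R")
  proof
    show "?L \<subseteq> ?R"
      by (auto simp: run_sorted_perms_def run_sorted_arrangements_def run_sorted_iff)
    show "?R \<subseteq> ?L"
    proof
      fix xs assume xs: "xs \<in> ?R"
      then obtain ys where "xs = 1 # ys"
        by (rule run_sorted_arrangements_hd[of _ _ 1]) (use assms in auto)
      with xs show "xs \<in> ?L"
        by (simp add: run_sorted_perms_def run_sorted_arrangements_def run_sorted_iff)
    qed
  qed
  then show ?thesis by (simp add: run_sorted_poly_def arrangement_poly_def)
qed

lemma arrangement_poly_image:
  assumes f: "strict_mono_on A f"
  shows "arrangement_poly (f ` A) = arrangement_poly A"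
proof -
  have inj: "inj_on f A" using f by (rule strict_mono_on_imp_inj_on)
  have arr: "set xs = A" if "xs \<in> run_sorted_arrangements A" for xs
    using that by (auto simp: run_sorted_arrangements_def permutations_of_set_def)
  have "run_sorted_arrangements (f ` A) = map f ` run_sorted_arrangements A"
  proof -
    have "sorted_wrt (<) (run_heads (map f xs)) \<longleftrightarrow> sorted_wrt (<) (run_heads xs)"
      if "xs \<in> permutations_of_set A" for xs
      by (rule sorted_run_heads_map_iff) (use that f in \<open>simp add: permutations_of_set_def\<close>)
    then show ?thesis
      unfolding run_sorted_arrangements_def permutations_of_set_image_inj[OF inj] by blast
  qed
  moreover have "inj_on (map f) (run_sorted_arrangements A)"
    by (rule inj_on_mapI, rule inj_on_subset[OF inj]) (use arr in blast)
  ultimately show ?thesis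
    unfolding arrangement_poly_def
    by (simp add: sum.reindex arr inv_count_map run_count_conv_run_heads run_heads_map f)
qed

text \<open>
  The tail left after cutting off a prefix uses an alphabet with gaps; the order isomorphism
  onto an initial segment carries it back to \<^const>\<open>run_sorted_poly\<close>.
\<close>
lemma arrangement_poly_eq_run_sorted_poly:
  assumes "finite A" "A \<noteq> {}"
  shows "arrangement_poly A = run_sorted_poly (card A)"
proof -
  obtain h where h: "bij_betw h {..<card A} A" "strict_mono_on {..<card A} h"
    using ex_bij_betw_strict_mono_card[OF assms(1)] by blast
  have shift: "(\<lambda>i. i - 1) ` {1..card A} = {..<card A}"
    by (auto simp: image_iff intro!: bexI[of _ "Suc _"])
  have "strict_mono_on {1..card A} (\<lambda>i. h (i - 1))"
    by (intro strict_mono_onI strict_mono_onD[OF h(2)]) auto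
  moreover have "(\<lambda>i. h (i - 1)) ` {1..card A} = A"
    using h(1) unfolding bij_betw_def shift[symmetric] image_image by simp
  ultimately have "arrangement_poly A = arrangement_poly {1..card A}"
    using arrangement_poly_image by metis
  moreover have "card A \<ge> 1" using assms by (simp add: Suc_le_eq card_gt_0_iff)
  ultimately show ?thesis by (simp add: run_sorted_poly_conv_arrangement_poly)
qed

section \<open>Splitting a run-sorted permutation in front of its entry 2\<close>

text \<open>
  Since \<open>y\<close> lies below all of \<open>s\<close>, it starts a new run unless \<open>s\<close> is empty, in
  which case it continues the run of \<open>x\<close>.
\<close>
lemma run_heads_split:
  assumes "x < y" "\<forall>z\<in>set s. y < z"
  shows "run_heads (x # s @ y # t) =
           x # descent_bottoms x s @ (if s = [] then [] else [y]) @ descent_bottoms y t"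
proof -
  have "last (x # s) < y \<longleftrightarrow> s = []" 
    using assms last_in_set[of s] by (cases "s = []") (auto dest: order.asym)
  then show ?thesis by (auto simp: descent_bottoms_append)
qed

text \<open>
  A descent inside \<open>x # s\<close> would create a run head in \<open>s\<close>, hence above \<open>y\<close>, although \<open>y\<close>
  is then a later run head. This is the step that forces \<open>s\<close> to be increasing.
\<close>
lemma sorted_run_heads_split_iff:
  assumes "x < y" "\<forall>z\<in>set s \<union> set t. y < z"
  shows "sorted_wrt (<) (run_heads (x # s @ y # t)) \<longleftrightarrow>
           sorted_wrt (<) (x # s) \<and> sorted_wrt (<) (run_heads (y # t))"
proof -
  have split: "run_heads (x # s @ y # t) =
      x # descent_bottoms x s @ (if s = [] then [] else [y]) @ descent_bottoms y t"
    using assms by (intro run_heads_split) auto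
  have t: "\<forall>z\<in>set (descent_bottoms y t). y < z"
    using assms set_descent_bottoms_subset by blast
  have "descent_bottoms x s = []" if "sorted_wrt (<) (run_heads (x # s @ y # t))"
  proof (rule ccontr)
    assume "descent_bottoms x s \<noteq> []"
    then obtain z where z: "z \<in> set (descent_bottoms x s)" by fastforce
    then have "z \<in> set s" using set_descent_bottoms_subset by blast
    moreover have "z < y"
    proof -
      have "s \<noteq> []" using \<open>z \<in> set s\<close> by auto
      with that z show ?thesis unfolding split by (simp add: sorted_wrt_append)
    qed
    ultimately show False using assms(2) by (auto dest: order.asym)
  qed
  moreover have "sorted_wrt (<) (run_heads (x # s @ y # t)) \<longleftrightarrow> sorted_wrt (<) (run_heads (y # t))"
    if "descent_bottoms x s = []"
    using that assms(1) t unfolding split by (auto simp: sorted_wrt_append)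
  ultimately show ?thesis unfolding descent_bottoms_eq_Nil_iff[symmetric] by blast
qed

definition splice_min :: "nat set \<times> nat list \<Rightarrow> nat list" where
  "splice_min = (\<lambda>(S, ys). 1 # sorted_list_of_set S @ ys)"

lemma arrangement_tail_Cons_2:
  assumes "ys \<in> run_sorted_arrangements ({2..n} - S)" "S \<subseteq> {3..n}" "n \<ge> 2"
  obtains t where "ys = 2 # t" "2 \<notin> set t" "set t = {3..n} - S" "distinct t"
proof -
  obtain t where t: "ys = 2 # t"
    by (rule run_sorted_arrangements_hd[OF assms(1), of 2]) (use assms in auto)
  have ys: "set ys = {2..n} - S" "distinct ys"
    using assms(1) by (auto simp: run_sorted_arrangements_def permutations_of_set_def)
  have "set t = set ys - {2}" using t ys(2) by auto
  also have "\<dots> = {3..n} - S" unfolding ys(1) by auto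
  finally show ?thesis using t ys that by simp
qed

text \<open>
  The inverse cuts a permutation in front of its entry 2, which is the first entry
  of every tail and never belongs to \<open>S\<close>.
\<close>
lemma bij_betw_splice_min:
  assumes n: "n \<ge> 2"
  shows "bij_betw splice_min (SIGMA S:Pow {3..n}. run_sorted_arrangements ({2..n} - S))
           (run_sorted_arrangements {1..n})" (is "bij_betw _ ?D ?R")
proof (rule bij_betw_imageI)
  show "inj_on splice_min ?D"
  proof (rule inj_onI, clarify)
    fix S ys S' ys'
    assume *: "splice_min (S, ys) = splice_min (S', ys')" "S \<subseteq> {3..n}" "S' \<subseteq> {3..n}"
      "ys \<in> run_sorted_arrangements ({2..n} - S)" "ys' \<in> run_sorted_arrangements ({2..n} - S')"
    obtain t where t: "ys = 2 # t" "2 \<notin> set t"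
      using arrangement_tail_Cons_2[OF *(4,2) n] by metis
    obtain t' where t': "ys' = 2 # t'"
      using arrangement_tail_Cons_2[OF *(5,3) n] by metis
    have fin: "finite S" "finite S'" using * by (auto dest: finite_subset)
    have "2 \<notin> S" "2 \<notin> S'" using * by auto
    then have eq: "sorted_list_of_set S = sorted_list_of_set S' \<and> t = t'"
      using *(1) fin t by (simp add: splice_min_def t' append_Cons_eq_iff)
    then have "S = S'" using fin by (metis set_sorted_list_of_set)
    with eq show "S = S' \<and> ys = ys'" by (simp add: t t')
  qed
  show "splice_min ` ?D = ?R"
  proof (intro equalityI subsetI)
    fix xs assume "xs \<in> splice_min ` ?D"
    then obtain S ys where xs: "xs = 1 # sorted_list_of_set S @ ys" and S: "S \<subseteq> {3..n}"
      and ys: "ys \<in> run_sorted_arrangements ({2..n} - S)"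
      by (auto simp: splice_min_def)
    obtain t where t: "ys = 2 # t" "set t = {3..n} - S" "distinct t" "2 \<notin> set t"
      using arrangement_tail_Cons_2[OF ys S n] by metis
    have fin: "finite S" using S by (auto dest: finite_subset)
    have "set xs = {1..n}" "distinct xs"
      using S fin t n by (auto simp: xs)
    moreover have "sorted_wrt (<) (run_heads xs)"
      unfolding xs t
      by (subst sorted_run_heads_split_iff)
        (use S fin t ys in \<open>auto simp: run_sorted_arrangements_def\<close>)
    ultimately show "xs \<in> ?R" by (simp add: run_sorted_arrangements_def permutations_of_set_def)
  next
    fix xs assume xs: "xs \<in> ?R"
    then have xs': "set xs = {1..n}" "distinct xs" "sorted_wrt (<) (run_heads xs)"
      by (auto simp: run_sorted_arrangements_def permutations_of_set_def)
    obtain zs where zs: "xs = 1 # zs"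
      by (rule run_sorted_arrangements_hd[OF xs, of 1]) (use n in auto)
    have "2 \<in> set xs" using xs'(1) n by simp
    then have "2 \<in> set zs" by (simp add: zs)
    then obtain s t where st: "zs = s @ 2 # t" by (meson split_list)
    have dist: "distinct (1 # s @ 2 # t)" and set: "set (1 # s @ 2 # t) = {1..n}"
      using xs' by (simp_all add: zs st)
    have "set s \<union> set t = set (1 # s @ 2 # t) - {1, 2}" using dist by auto
    also have "\<dots> = {3..n}" unfolding set by auto
    finally have un: "set s \<union> set t = {3..n}" .
    have "sorted_wrt (<) (1 # s) \<and> sorted_wrt (<) (run_heads (2 # t))"
    proof (rule sorted_run_heads_split_iff[THEN iffD1])
      show "\<forall>z\<in>set s \<union> set t. 2 < z" unfolding un by auto
      show "sorted_wrt (<) (run_heads (1 # s @ 2 # t))" using xs'(3) by (simp only: zs st)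
    qed simp
    moreover from this have "sorted_list_of_set (set s) = s"
      by (simp add: sorted_list_of_set.idem_if_sorted_distinct strict_sorted_iff)
    moreover have "set (2 # t) = {2..n} - set s"
    proof -
      have "set (2 # t) = insert 2 (set s \<union> set t) - set s" using dist by auto
      also have "insert 2 (set s \<union> set t) = {2..n}" unfolding un using n by auto
      finally show ?thesis .
    qed
    ultimately have "xs = splice_min (set s, 2 # t)" "(set s, 2 # t) \<in> ?D"
      using dist un
      by (auto simp: splice_min_def zs st run_sorted_arrangements_def permutations_of_set_def)
    then show "xs \<in> splice_min ` ?D" by blast
  qed
qed

text \<open>
  The summand \<open>card S\<close> comes from the inversions with the entry 2, which belongs to the tail
  but not to the ground set \<open>{3..n}\<close> from which \<open>S\<close> is chosen.
\<close>
lemma splice_min_statistics: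
  assumes S: "S \<subseteq> {3..n}" and ys: "ys \<in> run_sorted_arrangements ({2..n} - S)" and n: "n \<ge> 2"
  shows "inv_count (splice_min (S, ys)) = card S + cross_inv S ({3..n} - S) + inv_count ys"
    and "run_count (splice_min (S, ys)) = (if S = {} then 0 else 1) + run_count ys"
proof -
  obtain t where t: "ys = 2 # t" "set t = {3..n} - S" "distinct t" "2 \<notin> set t"
    using arrangement_tail_Cons_2[OF ys S n] by metis
  have fin: "finite S" using S by (auto dest: finite_subset)
  let ?s = "sorted_list_of_set S"
  have sorted: "sorted_wrt (<) (1 # ?s)" using S fin by auto
  have "inv_count ((1 # ?s) @ ys) =
      inv_count (1 # ?s) + cross_inv (set (1 # ?s)) (set ys) + inv_count ys"
    by (rule inv_count_append) (use S fin t in auto)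
  also have "inv_count (1 # ?s) = 0"
    using sorted by (intro inv_count_sorted strict_sorted_imp_sorted)
  also have "cross_inv (set (1 # ?s)) (set ys) = (\<Sum>s\<in>S. card {u \<in> insert 2 ({3..n} - S). u < s})"
  proof -
    have "1 \<notin> S" using S by auto
    moreover have "{u \<in> insert 2 ({3..n} - S). u < 1} = {}" by auto
    ultimately show ?thesis using fin t by (simp add: cross_inv_def)
  qed
  also have "\<dots> = (\<Sum>s\<in>S. Suc (card {u \<in> {3..n} - S. u < s}))"
  proof (rule sum.cong[OF refl])
    fix s assume "s \<in> S"
    then have "{u \<in> insert 2 ({3..n} - S). u < s} = insert 2 {u \<in> {3..n} - S. u < s}"
      using S by auto
    then show "card {u \<in> insert 2 ({3..n} - S). u < s} = Suc (card {u \<in> {3..n} - S. u < s})"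
      by simp
  qed
  also have "\<dots> = card S + cross_inv S ({3..n} - S)"
    by (simp add: cross_inv_def sum_Suc)
  finally show "inv_count (splice_min (S, ys)) = card S + cross_inv S ({3..n} - S) + inv_count ys"
    by (simp add: splice_min_def)
  have "descent_bottoms 1 ?s = []" using sorted by (simp only: descent_bottoms_eq_Nil_iff)
  moreover have "?s = [] \<longleftrightarrow> S = {}" using fin by simp
  moreover have "run_heads (1 # ?s @ 2 # t) =
      1 # descent_bottoms 1 ?s @ (if ?s = [] then [] else [2]) @ descent_bottoms 2 t"
    by (rule run_heads_split) (use S fin in auto)
  ultimately show "run_count (splice_min (S, ys)) = (if S = {} then 0 else 1) + run_count ys"
    by (simp add: splice_min_def t run_count_conv_run_heads)
qed

section \<open>The recurrence\<close>
lemma run_sorted_poly_subset_expansion: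
  assumes n: "n \<ge> 2"
  shows "run_sorted_poly n =
    (\<Sum>S\<in>Pow {3..n}. q_indet ^ (card S + cross_inv S ({3..n} - S)) *
       u_indet ^ (if S = {} then 0 else 1) * run_sorted_poly (n - card S - 1))"
proof -
  let ?R = run_sorted_arrangements
  let ?g = "\<lambda>xs. q_indet ^ inv_count xs * u_indet ^ run_count xs"
  have fin: "finite (?R A)" for A by (simp add: run_sorted_arrangements_def)
  have "run_sorted_poly n = sum ?g (?R {1..n})"
    using n by (simp add: run_sorted_poly_conv_arrangement_poly arrangement_poly_def)
  also have "\<dots> = (\<Sum>p\<in>(SIGMA S:Pow {3..n}. ?R ({2..n} - S)). ?g (splice_min p))"
    by (rule sum.reindex_bij_betw[OF bij_betw_splice_min[OF n], symmetric])
  also have "\<dots> = (\<Sum>S\<in>Pow {3..n}. \<Sum>ys\<in>?R ({2..n} - S). ?g (splice_min (S, ys)))"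
    by (subst sum.Sigma) (auto simp: fin)
  also have "\<dots> = (\<Sum>S\<in>Pow {3..n}. q_indet ^ (card S + cross_inv S ({3..n} - S)) *
       u_indet ^ (if S = {} then 0 else 1) * run_sorted_poly (n - card S - 1))"
  proof (rule sum.cong[OF refl])
    fix S assume "S \<in> Pow {3..n}"
    then have S: "S \<subseteq> {3..n}" by simp
    then have "card ({2..n} - S) = n - card S - 1"
      by (subst card_Diff_subset) (auto dest: finite_subset)
    moreover have "2 \<in> {2..n} - S" using n S by auto
    ultimately have "run_sorted_poly (n - card S - 1) = arrangement_poly ({2..n} - S)"
      by (metis arrangement_poly_eq_run_sorted_poly empty_iff finite_Diff finite_atLeastAtMost)
    then show "(\<Sum>ys\<in>?R ({2..n} - S). ?g (splice_min (S, ys))) =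
        q_indet ^ (card S + cross_inv S ({3..n} - S)) *
        u_indet ^ (if S = {} then 0 else 1) * run_sorted_poly (n - card S - 1)"
      by (simp add: arrangement_poly_def sum_distrib_left splice_min_statistics[OF S _ n]
          power_add mult_ac cong: sum.cong)
  qed
  finally show ?thesis .
qed

text \<open>
  Grouping the subset expansion by \<open>k = card S\<close>, the inner sums become Gaussian binomials; the
  group \<open>k = 0\<close>, consisting of the empty set alone, is the term without the factor \<open>u\<close>.
\<close>
theorem theorem2p1:
  "run_sorted_poly 1 = u_indet \<and>
   (\<forall>n\<ge>2. run_sorted_poly n =
      run_sorted_poly (n - 1) +
      u_indet * (\<Sum>k=1..n-2. q_indet ^ k * q_binomial (n - 2) k * run_sorted_poly (n - k - 1)))"
proof (intro conjI allI impI)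
  have "run_sorted_arrangements {1..1} = {[1]}"
    by (auto simp: run_sorted_arrangements_def)
  then show "run_sorted_poly 1 = u_indet"
    by (simp add: run_sorted_poly_conv_arrangement_poly arrangement_poly_def
        run_count_conv_run_heads inv_count_sorted)
next
  fix n :: nat
  assume n: "n \<ge> 2"
  let ?T = "{3..n}"
  let ?h = "\<lambda>S. q_indet ^ (card S + cross_inv S (?T - S)) * u_indet ^ (if S = {} then 0 else 1) *
    run_sorted_poly (n - card S - 1)"
  let ?f = "\<lambda>k. q_indet ^ k * q_binomial (n - 2) k * run_sorted_poly (n - k - 1)"
  \<comment> \<open>The block $1\,S$ is a run of its own exactly if $S$ is nonempty.\<close>
  let ?w = "\<lambda>k::nat. u_indet ^ (if k = 0 then 0 else 1)"
  have inner: "sum ?h {S \<in> Pow ?T. card S = k} = ?w k * ?f k" if "k \<le> n - 2" for k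
  proof -
    have "sum ?h {S \<in> Pow ?T. card S = k} = (\<Sum>S | S \<subseteq> ?T \<and> card S = k.
        q_indet ^ k * ?w k * run_sorted_poly (n - k - 1) * q_indet ^ cross_inv S (?T - S))"
    proof (rule sum.cong)
      fix S assume S: "S \<in> {S. S \<subseteq> ?T \<and> card S = k}"
      then have "finite S" by (auto dest: finite_subset)
      then have "S = {} \<longleftrightarrow> k = 0" using S by auto
      with S show "?h S = q_indet ^ k * ?w k * run_sorted_poly (n - k - 1) *
          q_indet ^ cross_inv S (?T - S)"
        by (simp add: power_add mult_ac)
    qed auto
    also have "\<dots> = q_indet ^ k * ?w k * run_sorted_poly (n - k - 1) * subset_inv_poly ?T k"
      by (simp add: subset_inv_poly_def sum_distrib_left)
    also have "subset_inv_poly ?T k = q_binomial (n - 2) k"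
      using subset_inv_poly_eq_q_binomial[of ?T k] that by simp
    finally show ?thesis by (simp only: mult_ac)
  qed
  have "card ` Pow ?T \<subseteq> {0..n - 2}"
    using card_mono[of ?T] by fastforce
  then have "run_sorted_poly n = (\<Sum>k=0..n-2. sum ?h {S \<in> Pow ?T. card S = k})"
    using run_sorted_poly_subset_expansion[OF n] sum.group[of "Pow ?T" "{0..n-2}" card ?h] by simp
  also have "\<dots> = (\<Sum>k=0..n-2. ?w k * ?f k)"
    by (rule sum.cong) (use inner in auto)
  also have "\<dots> = ?f 0 + (\<Sum>k=1..n-2. ?w k * ?f k)"
    by (simp add: sum.atLeast_Suc_atMost)
  also have "(\<Sum>k=1..n-2. ?w k * ?f k) = u_indet * (\<Sum>k=1..n-2. ?f k)"
    unfolding sum_distrib_left by (rule sum.cong) auto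
  also have "q_binomial (n - 2) 0 = 1"
    using subset_inv_poly_eq_q_binomial[of ?T 0] by (simp add: subset_inv_poly_0)
  finally show "run_sorted_poly n = run_sorted_poly (n - 1) + u_indet * (\<Sum>k=1..n-2. ?f k)"
    by simp
qed

end
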